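(* Let $C\subset\mathbb{Z}_2^n$ be a $7$-cap of dimension $5$. Then $C$ is complete in dimension $5$ (no point of the $5$-flat $\mathrm{aff}(C)$ outside $C$ can be added to $C$ to form a cap; equivalently $\mathrm{qc}(C)=\mathrm{aff}(C)$), and $\mathrm{exc}(C)$ contains a point of multiplicity at least $2$.
   Context: $\mathbb{Z}_2^n$ is the $n$-dimensional vector space over $\mathbb{Z}_2$. A quad is a set of four distinct elements $a,b,c,d$ with $a+b+c+d=\vec 0$; a cap is a subset containing no quad; a $k$-cap is a cap with $k$ elements. For $S\subset\mathbb{Z}_2^n$, $\mathrm{exc}(S)=\{a+b+c: a,b,c\in S\text{ distinct}\}$ and $\mathrm{qc}(S)=S\cup\mathrm{exc}(S)$; the multiplicity of $p\in\mathrm{exc}(S)$ is the number of $3$-element subsets $\{x,y,z\}\subset S$ with $x+y+z=p$. Over $\mathbb{Z}_2$, $\mathrm{aff}(S)$ is the set of sums of an odd number of elements of $S$; the dimension of a cap $C$ is the dimension of the flat $\mathrm{aff}(C)$. *)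

theory Defs
  imports "HOL-Analysis.Cartesian_Space" "HOL-Library.Z2"
begin

text \<open>The space \<open>\<int>\<^sub>2\<^sup>n\<close> is rendered as \<^typ>\<open>bit ^ 'n\<close>, where \<^typ>\<open>bit\<close> is the two-element field.\<close>

definition is_quad :: "(bit ^ 'n) set \<Rightarrow> bool" where
  "is_quad Q \<longleftrightarrow> (\<exists>a b c d. Q = {a, b, c, d} \<and> distinct [a, b, c, d] \<and> a + b + c + d = 0)"

definition is_cap :: "(bit ^ 'n) set \<Rightarrow> bool" where
  "is_cap C \<longleftrightarrow> \<not> (\<exists>Q. Q \<subseteq> C \<and> is_quad Q)"

definition is_k_cap :: "nat \<Rightarrow> (bit ^ 'n) set \<Rightarrow> bool" where
  "is_k_cap k C \<longleftrightarrow> is_cap C \<and> card C = k"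

definition exc :: "(bit ^ 'n) set \<Rightarrow> (bit ^ 'n) set" where
  "exc S = {a + b + c | a b c. a \<in> S \<and> b \<in> S \<and> c \<in> S \<and> distinct [a, b, c]}"

definition qc :: "(bit ^ 'n) set \<Rightarrow> (bit ^ 'n) set" where
  "qc S = S \<union> exc S"

definition multiplicity_exc :: "(bit ^ 'n) set \<Rightarrow> bit ^ 'n \<Rightarrow> nat" where
  "multiplicity_exc S p = card {T. T \<subseteq> S \<and> card T = 3 \<and> \<Sum>T = p}"

text \<open>Summing over finite subsets loses nothing against sums with repetitions, since equal
  summands cancel in pairs and this does not change the parity of the number of summands.\<close>

definition aff :: "(bit ^ 'n) set \<Rightarrow> (bit ^ 'n) set" where
  "aff S = {\<Sum>T | T. finite T \<and> T \<subseteq> S \<and> odd (card T)}"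

text \<open>The dimension of a flat is the linear dimension of the subspace of which it is a
  translate, i.e. of its set of differences.\<close>

definition flat_dim :: "(bit ^ 'n) set \<Rightarrow> nat" where
  "flat_dim F = vec.dim {x - y | x y. x \<in> F \<and> y \<in> F}"

definition cap_dim :: "(bit ^ 'n) set \<Rightarrow> nat" where
  "cap_dim C = flat_dim (aff C)"

definition complete_cap :: "(bit ^ 'n) set \<Rightarrow> bool" where
  "complete_cap C \<longleftrightarrow> is_cap C \<and> (\<forall>p \<in> aff C - C. \<not> is_cap (insert p C))"

end

theory Submission
  imports Defs
begin

text \<open>Seven points in a flat of dimension 5 satisfy an affine dependency: some nonempty
  subset \<open>Z\<close> of even size sums to \<open>0\<close>. Size 2 is impossible and size 4 would be a quad, so
  \<open>Z\<close> has six elements. Exchanging a subset of \<open>Z\<close> for its complement in \<open>Z\<close> preserves sums,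
  which turns every sum of 5 or 7 points into a sum of 1 or 3 points, and shows that the
  two halves of any splitting of \<open>Z\<close> into triples have the same sum.\<close>

lemma bit_vec_add_self [simp]: "x + x = (0 :: bit ^ 'n)"
  by (simp add: vec_eq_iff)

lemma bit_vec_diff_eq_add: "x - y = x + (y :: bit ^ 'n)"
  by (simp add: vec_eq_iff)

lemma bit_vec_add_eq_0_iff: "x + y = (0 :: bit ^ 'n) \<longleftrightarrow> x = y"
  by (metis bit_vec_diff_eq_add eq_iff_diff_eq_0)

text \<open>Equal summands cancel in pairs. An infinite \<open>A\<close> fits as well, since its sum
  and its \<open>card\<close> are both 0.\<close>

lemma sum_const_bit_vec: "(\<Sum>x\<in>A. (c :: bit ^ 'n)) = (if odd (card A) then c else 0)"
  by (induction A rule: infinite_finite_induct) (auto simp del: sum_constant)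

text \<open>The only nonzero scalar is 1, so a nontrivial linear relation is just the sum of the
  vectors in its support.\<close>

lemma dependent_bit_vec_obtains:
  fixes B :: "(bit ^ 'n) set"
  assumes "vec.dependent B"
  obtains T where "finite T" "T \<subseteq> B" "T \<noteq> {}" "\<Sum>T = 0"
proof -
  obtain t u where t: "finite t" "t \<subseteq> B" "(\<Sum>v\<in>t. u v *s v) = 0" "\<exists>v\<in>t. u v \<noteq> 0"
    using assms unfolding vec.dependent_explicit by blast
  let ?T = "{v\<in>t. u v \<noteq> 0}"
  have "\<Sum>?T = (\<Sum>v\<in>t. if u v \<noteq> 0 then v else 0)"
    using t(1) by (simp add: sum.inter_filter)
  also have "\<dots> = (\<Sum>v\<in>t. u v *s v)"
    by (intro sum.cong refl) (auto simp: vec_eq_iff)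
  finally have "\<Sum>?T = 0"
    using t(3) by simp
  with t that[of ?T] show thesis
    by auto
qed

lemma subset_aff: "S \<subseteq> aff S"
proof
  fix x assume "x \<in> S"
  then have "x = \<Sum>{x} \<and> finite {x} \<and> {x} \<subseteq> S \<and> odd (card {x})"
    by simp
  then show "x \<in> aff S"
    unfolding aff_def by blast
qed

text \<open>Moving a point \<open>c\<close> of \<open>C\<close> to the origin leaves
  \<open>card C - 1\<close> nonzero vectors in the direction space of \<open>aff C\<close>, too many
  to be independent.\<close>

lemma even_zero_sum_subset:
  fixes C :: "(bit ^ 'n) set"
  assumes "finite C" and "flat_dim (aff C) + 1 < card C"
  obtains Z where "Z \<subseteq> C" "Z \<noteq> {}" "even (card Z)" "\<Sum>Z = 0"
proof -
  from assms have "C \<noteq> {}"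
    by auto
  then obtain c where c: "c \<in> C"
    by blast
  let ?B = "(\<lambda>x. x + c) ` (C - {c})"
  have inj: "inj_on (\<lambda>x. x + c) A" for A
    by (simp add: inj_on_def)
  have "?B \<subseteq> {x - y | x y. x \<in> aff C \<and> y \<in> aff C}"
    using subset_aff[of C] c by (auto simp flip: bit_vec_diff_eq_add)
  then have "card ?B \<le> flat_dim (aff C)" if "\<not> vec.dependent ?B"
    unfolding flat_dim_def using that by (rule vec.independent_card_le_dim)
  moreover have "card ?B = card C - 1"
    using c assms(1) by (simp add: card_image[OF inj])
  ultimately have "vec.dependent ?B"
    using assms(2) by linarith
  then obtain T where T: "finite T" "T \<subseteq> ?B" "T \<noteq> {}" "\<Sum>T = 0"
    by (rule dependent_bit_vec_obtains)
  then obtain A where A: "A \<subseteq> C - {c}" "T = (\<lambda>x. x + c) ` A"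
    by (meson subset_imageE)
  have fin: "finite A" and "c \<notin> A" "A \<noteq> {}"
    using A T assms(1) by (auto intro: finite_subset)
  \<comment> \<open>Undoing the translation adds one \<open>c\<close> per element of
    \<open>A\<close>. A leftover \<open>c\<close> occurs exactly when \<open>card A\<close> is odd,
    and adjoining it to \<open>A\<close> then makes the size even.\<close>
  have sum: "\<Sum>A + (if odd (card A) then c else 0) = 0"
    using T(4) unfolding A(2) by (simp add: sum.reindex[OF inj] sum.distrib sum_const_bit_vec del: sum_constant)
  show thesis
  proof (cases "odd (card A)")
    case True
    then show thesis
      using that[of "insert c A"] A(1) c fin \<open>c \<notin> A\<close> sum by (auto simp: add.commute)
  next
    case False
    then show thesis
      using that[of A] A(1) \<open>A \<noteq> {}\<close> sum by auto
  qed
qed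

lemma is_quad_iff: "is_quad Q \<longleftrightarrow> card Q = 4 \<and> \<Sum>Q = 0"
proof
  assume "is_quad Q"
  then obtain a b c d where "Q = {a, b, c, d}" "distinct [a, b, c, d]" "a + b + c + d = 0"
    unfolding is_quad_def by blast
  then show "card Q = 4 \<and> \<Sum>Q = 0"
    by (simp add: add.assoc)
next
  assume Q: "card Q = 4 \<and> \<Sum>Q = 0"
  then obtain a R where R: "Q = insert a R" "a \<notin> R" "card R = 3"
    using card_Suc_eq[of Q 3] by auto
  then obtain b c d where bcd: "R = {b, c, d}" "distinct [b, c, d]"
    by (auto simp: card_3_iff)
  with R have "Q = {a, b, c, d}" "distinct [a, b, c, d]"
    by simp_all
  moreover from this Q have "a + b + c + d = 0"
    by (simp add: add.assoc)
  ultimately show "is_quad Q"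
    unfolding is_quad_def by blast
qed

lemma exc_eq: "exc S = {\<Sum>T | T. T \<subseteq> S \<and> card T = 3}"
proof safe
  fix p assume "p \<in> exc S"
  then obtain a b c where "a \<in> S" "b \<in> S" "c \<in> S" "distinct [a, b, c]" "p = a + b + c"
    unfolding exc_def by blast
  then show "\<exists>T. p = \<Sum>T \<and> T \<subseteq> S \<and> card T = 3"
    by (intro exI[of _ "{a, b, c}"]) (simp add: add.assoc)
next
  fix T assume T: "T \<subseteq> S" "card T = 3"
  then obtain a b c where "T = {a, b, c}" "distinct [a, b, c]"
    by (auto simp: card_3_iff)
  with T show "\<Sum>T \<in> exc S"
    unfolding exc_def by (auto simp: add.assoc)
qed

lemma qc_subset_aff:
  assumes "finite S"
  shows "qc S \<subseteq> aff S"
proof -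
  have "exc S \<subseteq> aff S"
  proof
    fix p assume "p \<in> exc S"
    then obtain T where T: "p = \<Sum>T" "T \<subseteq> S" "card T = 3"
      unfolding exc_eq by blast
    then have "finite T" "odd (card T)"
      using finite_subset[OF _ assms] by simp_all
    with T show "p \<in> aff S"
      unfolding aff_def by blast
  qed
  then show ?thesis
    using subset_aff unfolding qc_def by blast
qed

text \<open>A triple with sum \<open>p\<close>, together with \<open>p\<close> itself, has sum
  \<open>p + p = 0\<close>; as \<open>p\<close> is outside \<open>S\<close>, the four points are
  distinct.\<close>

lemma not_is_cap_insert_exc:
  assumes "p \<in> exc S" and "p \<notin> S"
  shows "\<not> is_cap (insert p S)"
proof -
  obtain T where T: "p = \<Sum>T" "T \<subseteq> S" "card T = 3"
    using assms(1) unfolding exc_eq by blast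
  then have "finite T" "p \<notin> T"
    using assms(2) by (auto intro: card_ge_0_finite)
  with T have "is_quad (insert p T)"
    by (simp add: is_quad_iff)
  with T(2) show ?thesis
    unfolding is_cap_def by blast
qed

lemma complete_cap_if_qc_eq_aff:
  assumes "is_cap C" and "qc C = aff C"
  shows "complete_cap C"
  using assms not_is_cap_insert_exc unfolding complete_cap_def qc_def by blast

text \<open>The two sums add up to 0, which in characteristic 2 means that they agree.\<close>

lemma zero_sum_complement:
  fixes Z :: "(bit ^ 'n) set"
  assumes "finite Z" "\<Sum>Z = 0" "A \<subseteq> Z"
  shows "\<Sum>(Z - A) = \<Sum>A"
  using sum.subset_diff[OF assms(3,1), of "\<lambda>x. x"] assms(2) by (simp add: bit_vec_add_eq_0_iff)

lemma cap_card_7_zero_sum_6: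
  assumes "is_k_cap 7 C" and "cap_dim C = 5"
  obtains Z where "Z \<subseteq> C" "card Z = 6" "\<Sum>Z = 0"
proof -
  have cap: "is_cap C" and card: "card C = 7"
    using assms(1) by (auto simp: is_k_cap_def)
  then have fin: "finite C"
    by (auto intro: card_ge_0_finite)
  then obtain Z where Z: "Z \<subseteq> C" "Z \<noteq> {}" "even (card Z)" "\<Sum>Z = 0"
    using even_zero_sum_subset[of C] assms(2) card unfolding cap_dim_def by auto
  have "card Z \<noteq> 0"
    using Z finite_subset[OF _ fin] by auto
  moreover have "card Z \<le> 7"
    using Z(1) fin card card_mono by metis
  moreover have "card Z \<noteq> 2"
  proof
    assume "card Z = 2"
    then obtain x y where "Z = {x, y}" "x \<noteq> y"
      by (auto simp: card_2_iff)
    with Z(4) show False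
      by (simp add: bit_vec_add_eq_0_iff)
  qed
  moreover have "card Z \<noteq> 4"
    using Z cap is_quad_iff unfolding is_cap_def by blast
  ultimately have "card Z = 6"
    using Z(3) by presburger
  with Z that show thesis
    by blast
qed

theorem theorem5p22:
  fixes C :: "(bit ^ 'n) set"
  assumes "is_k_cap 7 C" and "cap_dim C = 5"
  shows "complete_cap C \<and> qc C = aff C \<and> (\<exists>p \<in> exc C. multiplicity_exc C p \<ge> 2)"
proof -
  have cap: "is_cap C" and card: "card C = 7"
    using assms(1) by (auto simp: is_k_cap_def)
  then have fin: "finite C"
    by (auto intro: card_ge_0_finite)
  obtain Z where Z: "Z \<subseteq> C" "card Z = 6" "\<Sum>Z = 0"
    using cap_card_7_zero_sum_6[OF assms] .
  have finZ: "finite Z"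
    using Z fin finite_subset by blast
  have "aff C \<subseteq> qc C"
  proof
    fix p assume "p \<in> aff C"
    then obtain T where T: "finite T" "T \<subseteq> C" "odd (card T)" "p = \<Sum>T"
      unfolding aff_def by blast
    have small: "\<Sum>U \<in> qc C" if "U \<subseteq> C" "card U = 1 \<or> card U = 3" for U
      using that by (auto simp: qc_def exc_eq card_1_singleton_iff)
    \<comment> \<open>\<open>U\<close> is the symmetric difference of \<open>T\<close> and
      \<open>Z\<close>: the part of \<open>T\<close> inside \<open>Z\<close> is exchanged for its
      complement, the rest of \<open>T\<close> is kept.\<close>
    define U where "U = (Z - T \<inter> Z) \<union> (T - Z)"
    have "U \<subseteq> C"
      using T(2) Z(1) unfolding U_def by blast
    have "\<Sum>U = \<Sum>(Z - T \<inter> Z) + \<Sum>(T - Z)"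
      unfolding U_def using finZ T(1) by (intro sum.union_disjoint) auto
    also have "\<dots> = \<Sum>(T \<inter> Z) + \<Sum>(T - Z)"
      using zero_sum_complement[OF finZ Z(3)] by simp
    also have "\<dots> = p"
      using T by (simp add: sum.Int_Diff[of T _ Z])
    finally have sumU: "\<Sum>U = p" .
    have "card U = card (Z - T \<inter> Z) + card (T - Z)"
      unfolding U_def using finZ T(1) by (intro card_Un_disjoint) auto
    moreover have "card (Z - T \<inter> Z) = 6 - card (T \<inter> Z)"
      using finZ Z(2) by (simp add: card_Diff_subset)
    moreover have "card (T \<inter> Z) \<le> 6"
      using finZ Z(2) card_mono[of Z "T \<inter> Z"] by simp
    moreover have "card T = card (T \<inter> Z) + card (T - Z)"
      using T(1) by (metis card_Int_Diff)
    \<comment> \<open>\<open>Z\<close> misses exactly one point of \<open>C\<close>.\<close>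
    moreover have "card (T - Z) = 0 \<or> card (T - Z) = 1"
      using card_mono[of "C - Z" "T - Z"] fin finZ T(2) Z card by (auto simp: card_Diff_subset le_Suc_eq)
    moreover have "card T = 1 \<or> card T = 3 \<or> card T = 5 \<or> card T = 7"
      using T(3) card_mono[OF fin T(2)] unfolding card by presburger
    \<comment> \<open>If \<open>card T = 5\<close>, then \<open>U\<close> has 1 or 3 elements,
      according to whether \<open>T\<close> lies inside \<open>Z\<close>; if
      \<open>card T = 7\<close>, then \<open>U\<close> is the single point of \<open>C\<close>
      outside \<open>Z\<close>.\<close>
    ultimately have "card T = 1 \<or> card T = 3 \<or> card U = 1 \<or> card U = 3"
      by (elim disjE) simp_all
    then show "p \<in> qc C"
      using small[OF T(2)] small[OF \<open>U \<subseteq> C\<close>] T(4) sumU by metis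
  qed
  with qc_subset_aff[OF fin] have "qc C = aff C"
    by blast
  moreover have "\<exists>p \<in> exc C. multiplicity_exc C p \<ge> 2"
  proof -
    \<comment> \<open>Any triple in \<open>Z\<close> will do: its complement in \<open>Z\<close> is
      a second triple with the same sum, so \<open>\<Sum>A\<close> is counted at least
      twice.\<close>
    obtain A where A: "A \<subseteq> Z" "card A = 3"
      using obtain_subset_with_card_n[of 3 Z] Z(2) by auto
    have cardB: "card (Z - A) = 3"
      using A Z(2) finite_subset[OF A(1) finZ] by (simp add: card_Diff_subset)
    have "A \<noteq> {}"
      using A by auto
    then have ne: "A \<noteq> Z - A"
      by blast
    let ?M = "{T. T \<subseteq> C \<and> card T = 3 \<and> \<Sum>T = \<Sum>A}"
    have "{A, Z - A} \<subseteq> ?M"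
      using A Z cardB zero_sum_complement[OF finZ Z(3) A(1)] by auto
    moreover have "finite ?M"
      using fin by (auto intro: finite_subset[of _ "Pow C"])
    ultimately have "card {A, Z - A} \<le> card ?M"
      by (intro card_mono)
    then have "multiplicity_exc C (\<Sum>A) \<ge> 2"
      using ne unfolding multiplicity_exc_def by simp
    moreover have "\<Sum>A \<in> exc C"
      using A Z(1) by (auto simp: exc_eq)
    ultimately show ?thesis
      by blast
  qed
  ultimately show ?thesis
    using complete_cap_if_qc_eq_aff cap by blast
qed

end
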